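(* Let $(H_j,d_j)_{j=0}^\infty$ be non-empty complete metric spaces forming a decreasing chain of sets $H_0\supset H_1\supset H_2\supset\ldots$, and let $\alpha_j>0$ and $\varkappa_j>0$ ($j\geqslant 1$) be constants such that $$d_j(x,y)\leqslant \alpha_{j+1}\,d_{j+1}(x,y)\quad\text{for all } x,y\in H_{j+1},\ j=0,1,\ldots,$$ $$\limsup_{j\to\infty}\alpha_j\varkappa_j<1.$$ Let $P:H_0\to H_0$ be a map such that, for all $j=0,1,\ldots$, $$P H_j\subset H_{j+1},\qquad d_{j+1}(P(x),P(y))\leqslant \varkappa_{j+1}\,d_j(x,y)\quad\text{for all } x,y\in H_j.$$ Set $S=\bigcap_{j\geqslant 0}H_j$. Then the map $P$ has a unique fixed point $x_\infty$, and $x_\infty\in S$. Moreover, for all $x\in H_0$, the sequence $(x_m)_{m\geqslant 0}$ defined by $x_0=x$, $x_m=P^{\circ m}x$ for $m\geqslant 1$, satisfies, for all integers $n\geqslant j\geqslant 0$, $$d_j(x_\infty,x_n)\leqslant C\,\alpha_n\varkappa_n\,\alpha_{n-1}\varkappa_{n-1}\cdots\alpha_{j+1}\varkappa_{j+1}\,d_j(x_{1+j},x_j),$$ where $$C=\sup_{n\geqslant 0}\ \sum_{m=0}^\infty \alpha_{n+m}\varkappa_{n+m}\,\alpha_{n+m-1}\varkappa_{n+m-1}\cdots\alpha_{n+1}\varkappa_{n+1}.$$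
   Context: $P^{\circ m}$ denotes the $m$-fold composition of $P$ with itself. Empty products equal $1$: in the definition of $C$ the term with $m=0$ equals $1$, and for $n=j$ the product $\alpha_n\varkappa_n\cdots\alpha_{j+1}\varkappa_{j+1}$ equals $1$. The metrics $d_j$ on the different $H_j$ need not be restrictions of one another. The inclusions $H_{j+1}\subset H_j$ are inclusions of sets. *)

theory Defs
  imports "HOL-Analysis.Analysis"
begin

text \<open>
  The products \<open>q n * \<dots> * q (j + 1)\<close> are written \<open>\<Prod>i\<in>{j<..n}. q i\<close>, which is 1 for \<open>n = j\<close>;
  here \<open>q i = \<alpha> i * \<kappa> i\<close>. The value \<open>q 0\<close> is never used.
  The real-valued series and supremum below are only meaningful if the series
  converge and their sums are bounded; \<open>chain_const_wf\<close> expresses exactly this.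
\<close>

definition chain_series :: "(nat \<Rightarrow> real) \<Rightarrow> (nat \<Rightarrow> real) \<Rightarrow> nat \<Rightarrow> nat \<Rightarrow> real" where
  "chain_series \<alpha> \<kappa> n m = (\<Prod>i\<in>{n<..n + m}. \<alpha> i * \<kappa> i)"

definition chain_const :: "(nat \<Rightarrow> real) \<Rightarrow> (nat \<Rightarrow> real) \<Rightarrow> real" where
  "chain_const \<alpha> \<kappa> = (SUP n. \<Sum>m. chain_series \<alpha> \<kappa> n m)"

definition chain_const_wf :: "(nat \<Rightarrow> real) \<Rightarrow> (nat \<Rightarrow> real) \<Rightarrow> bool" where
  "chain_const_wf \<alpha> \<kappa> \<longleftrightarrow>
     (\<forall>n. summable (chain_series \<alpha> \<kappa> n)) \<and> bdd_above (range (\<lambda>n. \<Sum>m. chain_series \<alpha> \<kappa> n m))"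

end

theory Submission
  imports Defs
begin

text \<open>
  With \<open>q i = \<alpha> i * \<kappa> i\<close>, moving from level \<open>j\<close> up to level \<open>j + m\<close> by \<open>P\<close> and back down by the
  metric comparison shows that the \<open>m\<close>-th iterate of \<open>P\<close> on \<open>(H j, d j)\<close> has Lipschitz constant
  \<open>q (j + 1) * \<dots> * q (j + m)\<close>. As \<open>limsup q < 1\<close>, these products decay geometrically, uniformly
  in \<open>j\<close>, so each orbit is Cauchy for every \<open>d j\<close>; the comparison of consecutive metrics forces
  all these limits to agree, which places the limit in every \<open>H j\<close>.
\<close>

text \<open>The triangle inequality bounds \<open>d (\<sigma> n) (\<sigma> (n + k))\<close> by the
  tail of \<open>a\<close> from \<open>n\<close>, uniformly in \<open>k\<close>. These tails tend to
  0, so the sequence is Cauchy; the same tails control the distance to the limit and later yield the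
  error estimate.\<close>

lemma (in Metric_space) mcomplete_summable_steps:
  assumes "mcomplete" and ran: "range \<sigma> \<subseteq> M" and sum: "summable a"
    and step: "\<And>n. d (\<sigma> n) (\<sigma> (Suc n)) \<le> a n"
  obtains l where "l \<in> M" "(\<lambda>n. d (\<sigma> n) l) \<longlonglongrightarrow> 0" "\<And>n. d l (\<sigma> n) \<le> (\<Sum>m. a (n + m))"
proof -
  have inM: "\<sigma> n \<in> M" for n using ran by auto
  have a0: "a n \<ge> 0" for n using step[of n] nonneg[of "\<sigma> n" "\<sigma> (Suc n)"] by linarith
  have sum': "summable (\<lambda>m. a (n + m))" for n
    using sum summable_iff_shift[of a n] by (simp add: add.commute)
  have fin: "d (\<sigma> n) (\<sigma> (n + k)) \<le> (\<Sum>m<k. a (n + m))" for n k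
  proof (induction k)
    case 0
    then show ?case using inM by simp
  next
    case (Suc k)
    have "d (\<sigma> n) (\<sigma> (n + Suc k)) \<le> d (\<sigma> n) (\<sigma> (n + k)) + d (\<sigma> (n + k)) (\<sigma> (Suc (n + k)))"
      using triangle inM by simp
    with Suc step[of "n + k"] show ?case by simp
  qed
  have tail: "d (\<sigma> n) (\<sigma> (n + k)) \<le> (\<Sum>m. a (n + m))" for n k
    using fin[of n k] sum_le_suminf[OF sum', of "{..<k}" n] a0 by force
  have tail_tendsto: "(\<lambda>n. \<Sum>m. a (n + m)) \<longlonglongrightarrow> 0"
    using suminf_exist_split2[OF sum] by (simp add: add.commute)
  have "MCauchy \<sigma>"
    unfolding MCauchy_def
  proof (intro conjI allI impI ran)
    fix \<epsilon> :: real assume "\<epsilon> > 0"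
    then obtain N where N: "(\<Sum>m. a (N + m)) < \<epsilon> / 2"
      using order_tendstoD(2)[OF tail_tendsto, of "\<epsilon> / 2"]
      unfolding eventually_sequentially by auto
    have close: "d (\<sigma> N) (\<sigma> n) < \<epsilon> / 2" if "N \<le> n" for n
      using tail[of N "n - N"] N that by simp
    have "d (\<sigma> n) (\<sigma> n') < \<epsilon>" if "N \<le> n" "N \<le> n'" for n n'
      using triangle'[OF inM inM inM, of n n' N] close[OF that(1)] close[OF that(2)] commute
      by (smt (verit) field_sum_of_halves)
    then show "\<exists>N. \<forall>n n'. N \<le> n \<longrightarrow> N \<le> n' \<longrightarrow> d (\<sigma> n) (\<sigma> n') < \<epsilon>" by blast
  qed
  then obtain l where "limitin mtopology \<sigma> l sequentially"
    using \<open>mcomplete\<close> unfolding mcomplete_def by blast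
  then have l: "l \<in> M" "(\<lambda>n. d (\<sigma> n) l) \<longlonglongrightarrow> 0"
    by (auto simp: limitin_metric_dist_null)
  \<comment> \<open>Go from \<open>l\<close> to \<open>\<sigma> n\<close> through the later point
    \<open>\<sigma> (k + n)\<close>: its distance to \<open>l\<close> vanishes as \<open>k\<close>
    grows, and its distance to \<open>\<sigma> n\<close> stays below the tail.\<close>
  have "d l (\<sigma> n) \<le> (\<Sum>m. a (n + m))" for n
  proof -
    have "(\<lambda>k. d (\<sigma> (k + n)) l + (\<Sum>m. a (n + m))) \<longlonglongrightarrow> 0 + (\<Sum>m. a (n + m))"
      by (intro tendsto_intros LIMSEQ_ignore_initial_segment l)
    moreover have "d l (\<sigma> n) \<le> d (\<sigma> (k + n)) l + (\<Sum>m. a (n + m))" for k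
      using triangle[of l "\<sigma> (k + n)" "\<sigma> n"] inM l(1) tail[of n k] commute
      by (metis add.commute add_left_mono order_trans)
    ultimately show ?thesis
      by (metis (no_types, lifting) LIMSEQ_le_const add_0)
  qed
  with l that show thesis by blast
qed

text \<open>Convergence is phrased through real distances, so that it can be carried from one metric
  to another by sandwiching.\<close>

lemma (in Metric_space) dist_null_unique:
  assumes "x \<in> M" "y \<in> M" "\<And>n. \<sigma> n \<in> M"
    and "(\<lambda>n. d (\<sigma> n) x) \<longlonglongrightarrow> 0" "(\<lambda>n. d (\<sigma> n) y) \<longlonglongrightarrow> 0"
  shows "x = y"
proof -
  have "(\<lambda>n. d (\<sigma> n) x + d (\<sigma> n) y) \<longlonglongrightarrow> 0 + 0"
    by (intro tendsto_add assms)
  moreover have "d x y \<le> d (\<sigma> n) x + d (\<sigma> n) y" for n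
    using triangle[OF assms(1,3,2)] commute by metis
  ultimately have "d x y \<le> 0"
    by (metis (no_types, lifting) LIMSEQ_le_const add_0)
  then show ?thesis using assms(1,2) nonneg zero by (metis antisym)
qed

text \<open>Splitting the product at \<open>n\<close> separates the prefactor of the error estimate
  from a term of the series defining the constant.\<close>

lemma chain_series_add:
  assumes "j \<le> n"
  shows "chain_series \<alpha> \<kappa> j (n - j + m) = (\<Prod>i\<in>{j<..n}. \<alpha> i * \<kappa> i) * chain_series \<alpha> \<kappa> n m"
proof -
  have "{j<..n + m} = {j<..n} \<union> {n<..n + m}" using assms by auto
  then show ?thesis
    using assms unfolding chain_series_def by (simp add: prod.union_disjoint)
qed

text \<open>For \<open>r\<close> strictly between the limsup and 1, only finitely many factors reach
  \<open>r\<close>. A window \<open>{n<..n + m}\<close> meets each of these indices at most once, so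
  their total excess over \<open>r\<close> is bounded by one \<open>K\<close>, independent of
  \<open>n\<close> and \<open>m\<close>.\<close>

lemma chain_series_geometric_bound:
  assumes pos: "\<And>i. i \<ge> 1 \<Longrightarrow> 0 < \<alpha> i * \<kappa> i"
    and limsup_less: "limsup (\<lambda>i. ereal (\<alpha> i * \<kappa> i)) < 1"
  shows "\<exists>r>0. r < 1 \<and> (\<exists>K. \<forall>n m. chain_series \<alpha> \<kappa> n m \<le> K * r ^ m)"
proof -
  obtain r where lim_r: "limsup (\<lambda>i. ereal (\<alpha> i * \<kappa> i)) < ereal r" "ereal r < 1"
    using limsup_less ereal_dense2 by blast
  then obtain N where N: "\<And>i. i \<ge> N \<Longrightarrow> \<alpha> i * \<kappa> i < r"
    using Limsup_lessD[OF lim_r(1)] unfolding eventually_sequentially by auto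
  \<comment> \<open>Positivity of \<open>r\<close> follows from a single positive factor lying below
    it.\<close>
  have r: "0 < r" "r < 1"
    using N[of "Suc N"] pos[of "Suc N"] lim_r(2) by auto
  \<comment> \<open>Here \<open>b i * r\<close> is the maximum of \<open>r\<close> and
    \<open>\<alpha> i * \<kappa> i\<close>. The cutoff at 1 makes products of \<open>b\<close> grow
    with the index set, so a window can be enlarged to all of \<open>{..N}\<close>.\<close>
  define b where "b = (\<lambda>i. max 1 (\<alpha> i * \<kappa> i / r))"
  have b_eq_1: "b i = 1" if "\<not> i \<le> N" for i
    using N[of i] that r by (simp add: b_def)
  have "chain_series \<alpha> \<kappa> n m \<le> (\<Prod>i\<le>N. b i) * r ^ m" for n m
  proof -
    have "chain_series \<alpha> \<kappa> n m \<le> (\<Prod>i\<in>{n<..n + m}. b i * r)"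
      unfolding chain_series_def
      by (rule prod_mono) (use r pos in \<open>auto simp: b_def less_imp_le max_def field_simps\<close>)
    also have "\<dots> = (\<Prod>i\<in>{n<..n + m}. b i) * r ^ m"
      by (simp add: prod.distrib)
    also have "(\<Prod>i\<in>{n<..n + m}. b i) = (\<Prod>i\<in>{n<..n + m} \<inter> {..N}. b i)"
      by (rule prod.mono_neutral_right) (auto simp: b_eq_1)
    also have "\<dots> \<le> (\<Prod>i\<le>N. b i)"
      by (rule prod_mono2) (auto simp: b_def)
    finally show ?thesis using r by simp
  qed
  with r show ?thesis by blast
qed

text \<open>The bound does not involve \<open>n\<close>, so a single geometric series dominates all
  the series: they converge, and their sums have a common bound.\<close>

lemma chain_const_wf_if_geometric:
  assumes "\<And>n m. 0 \<le> chain_series \<alpha> \<kappa> n m"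
    and "0 < r" "r < 1" and bound: "\<And>n m. chain_series \<alpha> \<kappa> n m \<le> K * r ^ m"
  shows "chain_const_wf \<alpha> \<kappa>"
proof -
  have geo: "summable (\<lambda>m. K * r ^ m)"
    using assms(2,3) by (intro summable_mult summable_geometric) simp
  have S: "summable (chain_series \<alpha> \<kappa> n)" for n
    by (rule summable_comparison_test'[OF geo]) (use assms in auto)
  then have "(\<Sum>m. chain_series \<alpha> \<kappa> n m) \<le> (\<Sum>m. K * r ^ m)" for n
    by (intro suminf_le bound geo)
  with S show ?thesis
    unfolding chain_const_wf_def by (auto intro!: bdd_aboveI)
qed

theorem lemma1:
  fixes H :: "nat \<Rightarrow> 'a set"
    and d :: "nat \<Rightarrow> 'a \<Rightarrow> 'a \<Rightarrow> real"
    and \<alpha> \<kappa> :: "nat \<Rightarrow> real"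
    and P :: "'a \<Rightarrow> 'a"
  assumes metric: "\<And>j. Metric_space (H j) (d j)"
    and complete: "\<And>j. Metric_space.mcomplete (H j) (d j)"
    and nonempty: "\<And>j. H j \<noteq> {}"
    and chain: "\<And>j. H (Suc j) \<subseteq> H j"
    and alpha_pos: "\<And>j. j \<ge> 1 \<Longrightarrow> \<alpha> j > 0"
    and kappa_pos: "\<And>j. j \<ge> 1 \<Longrightarrow> \<kappa> j > 0"
    and metric_le: "\<And>j x y. x \<in> H (Suc j) \<Longrightarrow> y \<in> H (Suc j) \<Longrightarrow>
                      d j x y \<le> \<alpha> (Suc j) * d (Suc j) x y"
    and limsup_less: "limsup (\<lambda>j. ereal (\<alpha> j * \<kappa> j)) < 1"
    and P_maps: "P ` H 0 \<subseteq> H 0"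
    and P_chain: "\<And>j. P ` H j \<subseteq> H (Suc j)"
    and P_lipschitz: "\<And>j x y. x \<in> H j \<Longrightarrow> y \<in> H j \<Longrightarrow>
                      d (Suc j) (P x) (P y) \<le> \<kappa> (Suc j) * d j x y"
  shows "chain_const_wf \<alpha> \<kappa> \<and>
         (\<exists>x_inf. x_inf \<in> H 0 \<and> P x_inf = x_inf \<and>
            (\<forall>y\<in>H 0. P y = y \<longrightarrow> y = x_inf) \<and>
            x_inf \<in> (\<Inter>j. H j) \<and>
            (\<forall>x\<in>H 0. \<forall>n j. j \<le> n \<longrightarrow>
               d j x_inf ((P ^^ n) x)
                 \<le> chain_const \<alpha> \<kappa> * (\<Prod>i\<in>{j<..n}. \<alpha> i * \<kappa> i)
                    * d j ((P ^^ (1 + j)) x) ((P ^^ j) x)))"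
proof -

  \<comment> \<open>Positivity of the factors and finiteness of the constant\<close>
  have q_pos: "0 < \<alpha> i * \<kappa> i" if "i \<ge> 1" for i
    using alpha_pos kappa_pos that by simp
  have series_nonneg: "0 \<le> chain_series \<alpha> \<kappa> n m" for n m
    unfolding chain_series_def by (rule prod_nonneg) (use q_pos in \<open>auto simp: less_imp_le\<close>)
  obtain r K where r: "0 < r" "r < 1" and geo: "\<And>n m. chain_series \<alpha> \<kappa> n m \<le> K * r ^ m"
    using chain_series_geometric_bound[of \<alpha> \<kappa>, OF q_pos limsup_less] by auto
  have wf: "chain_const_wf \<alpha> \<kappa>"
    by (rule chain_const_wf_if_geometric[OF series_nonneg r geo])
  \<comment> \<open>The boundedness contained in \<open>chain_const_wf\<close> is what makes the
    real supremum an upper bound of the sums.\<close>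
  then have series_summable: "summable (chain_series \<alpha> \<kappa> n)"
    and series_le_const: "(\<Sum>m. chain_series \<alpha> \<kappa> n m) \<le> chain_const \<alpha> \<kappa>" for n
    unfolding chain_const_wf_def chain_const_def by (auto intro: cSUP_upper)

  \<comment> \<open>Lipschitz constants of the iterates\<close>
  have iter_mem: "(P ^^ m) x \<in> H (j + m)" if "x \<in> H j" for x j m
    using that P_chain by (induction m) (auto simp: image_subset_iff)
  have chain_add: "H (j + m) \<subseteq> H j" for j m
    using chain by (induction m) auto
  have iter_mem': "(P ^^ m) x \<in> H j" if "x \<in> H 0" "j \<le> m" for x j m
    using iter_mem[OF that(1), of m] chain_add[of j "m - j"] that(2) by auto
  have up: "d (j + m) ((P ^^ m) x) ((P ^^ m) y) \<le> (\<Prod>i\<in>{j<..j + m}. \<kappa> i) * d j x y"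
    if "x \<in> H j" "y \<in> H j" for x y j m
  proof (induction m)
    case (Suc m)
    have "d (j + Suc m) ((P ^^ Suc m) x) ((P ^^ Suc m) y)
        \<le> \<kappa> (Suc (j + m)) * d (j + m) ((P ^^ m) x) ((P ^^ m) y)"
      using P_lipschitz[OF iter_mem[OF that(1)] iter_mem[OF that(2)]] by simp
    also have "\<dots> \<le> \<kappa> (Suc (j + m)) * ((\<Prod>i\<in>{j<..j + m}. \<kappa> i) * d j x y)"
      using Suc kappa_pos[of "Suc (j + m)"] by (intro mult_left_mono) auto
    also have "\<dots> = (\<Prod>i\<in>{j<..j + Suc m}. \<kappa> i) * d j x y"
      by (simp add: atLeastSucAtMost_greaterThanAtMost[symmetric] prod.nat_ivl_Suc')
    finally show ?case .
  qed simp
  have down: "d j x y \<le> (\<Prod>i\<in>{j<..j + m}. \<alpha> i) * d (j + m) x y"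
    if "x \<in> H (j + m)" "y \<in> H (j + m)" for x y j m
    using that
  proof (induction m)
    case (Suc m)
    then have "d j x y \<le> (\<Prod>i\<in>{j<..j + m}. \<alpha> i) * d (j + m) x y"
      using chain[of "j + m"] by auto
    also have "\<dots> \<le> (\<Prod>i\<in>{j<..j + m}. \<alpha> i) * (\<alpha> (Suc (j + m)) * d (Suc (j + m)) x y)"
      using Suc.prems metric_le alpha_pos
      by (intro mult_left_mono prod_nonneg) (auto simp: less_imp_le)
    also have "\<dots> = (\<Prod>i\<in>{j<..j + Suc m}. \<alpha> i) * d (j + Suc m) x y"
      by (simp add: atLeastSucAtMost_greaterThanAtMost[symmetric] prod.nat_ivl_Suc')
    finally show ?case .
  qed simp
  have iter_lipschitz: "d j ((P ^^ m) x) ((P ^^ m) y) \<le> chain_series \<alpha> \<kappa> j m * d j x y"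
    if "x \<in> H j" "y \<in> H j" for x y j m
  proof -
    have "d j ((P ^^ m) x) ((P ^^ m) y)
        \<le> (\<Prod>i\<in>{j<..j + m}. \<alpha> i) * d (j + m) ((P ^^ m) x) ((P ^^ m) y)"
      by (intro down iter_mem that)
    also have "\<dots> \<le> (\<Prod>i\<in>{j<..j + m}. \<alpha> i) * ((\<Prod>i\<in>{j<..j + m}. \<kappa> i) * d j x y)"
      using alpha_pos by (intro mult_left_mono up that prod_nonneg) (auto simp: less_imp_le)
    finally show ?thesis by (simp add: chain_series_def prod.distrib mult.assoc)
  qed

  \<comment> \<open>Uniqueness of the fixed point\<close>
  have unique: "x = y" if xy: "x \<in> H 0" "y \<in> H 0" "P x = x" "P y = y" for x y
  proof -
    have fixed: "(P ^^ m) x = x" "(P ^^ m) y = y" for m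
      using that(3,4) by (induction m) auto
    \<comment> \<open>The left side is constant in \<open>m\<close>, while the factors on the right
      are terms of a convergent series and tend to 0.\<close>
    have "d 0 x y \<le> chain_series \<alpha> \<kappa> 0 m * d 0 x y" for m
      using iter_lipschitz[OF xy(1,2), of m] by (simp add: fixed)
    moreover have "(\<lambda>m. chain_series \<alpha> \<kappa> 0 m * d 0 x y) \<longlonglongrightarrow> 0 * d 0 x y"
      by (intro tendsto_intros summable_LIMSEQ_zero series_summable)
    ultimately have "d 0 x y \<le> 0"
      by (metis (no_types, lifting) LIMSEQ_le_const mult_zero_left)
    then show ?thesis
      using Metric_space.zero[OF metric xy(1,2)] Metric_space.nonneg[OF metric, of 0 x y] by simp
  qed

  \<comment> \<open>Limit of an orbit and its error estimate\<close>
  have limit: "\<exists>l. (\<forall>j. l \<in> H j) \<and> P l = l \<and> (\<forall>n j. j \<le> n \<longrightarrow> d j l ((P ^^ n) x)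
      \<le> chain_const \<alpha> \<kappa> * (\<Prod>i\<in>{j<..n}. \<alpha> i * \<kappa> i) * d j ((P ^^ (1 + j)) x) ((P ^^ j) x))"
    if x: "x \<in> H 0" for x
  proof -
    define D where "D = (\<lambda>j. d j ((P ^^ (1 + j)) x) ((P ^^ j) x))"
    have D_nonneg: "0 \<le> D j" for j
      unfolding D_def by (rule Metric_space.nonneg[OF metric])
    \<comment> \<open>Each level first gets its own limit, since convergence in \<open>d 0\<close>
      alone does not place the limit in \<open>H j\<close>. The orbit is read from index
      \<open>j\<close> on, where it is known to lie in \<open>H j\<close>.\<close>
    have "\<exists>l. l \<in> H j \<and> (\<lambda>n. d j ((P ^^ (j + n)) x) l) \<longlonglongrightarrow> 0 \<and>
        (\<forall>n. d j l ((P ^^ (j + n)) x) \<le> (\<Sum>m. chain_series \<alpha> \<kappa> j (n + m) * D j))" for j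
    proof -
      interpret Metric_space "H j" "d j" by (rule metric)
      have ran: "range (\<lambda>n. (P ^^ (j + n)) x) \<subseteq> H j"
        using iter_mem'[OF x] by auto
      \<comment> \<open>Both points are \<open>n\<close>-th iterates, of \<open>(P ^^ j) x\<close>
        and of its successor, which lie in \<open>H j\<close> at distance
        \<open>D j\<close>.\<close>
      have step: "d j ((P ^^ (j + n)) x) ((P ^^ (j + Suc n)) x) \<le> chain_series \<alpha> \<kappa> j n * D j" for n
      proof -
        have "(P ^^ (j + n)) x = (P ^^ n) ((P ^^ j) x)"
          by (metis add.commute comp_apply funpow_add)
        moreover have "(P ^^ (j + Suc n)) x = (P ^^ n) ((P ^^ (1 + j)) x)"
          by (metis add.assoc add.commute comp_apply funpow_add plus_1_eq_Suc)
        ultimately show ?thesis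
          using iter_lipschitz[OF iter_mem'[OF x] iter_mem'[OF x], of j j "1 + j" n]
          by (simp only: D_def commute)
      qed
      from mcomplete_summable_steps[OF complete ran summable_mult2[OF series_summable] step]
      show ?thesis by metis
    qed
    then obtain l where mem: "\<And>j. l j \<in> H j"
      and conv: "\<And>j. (\<lambda>n. d j ((P ^^ (j + n)) x) (l j)) \<longlonglongrightarrow> 0"
      and bound: "\<And>j n. d j (l j) ((P ^^ (j + n)) x) \<le> (\<Sum>m. chain_series \<alpha> \<kappa> j (n + m) * D j)"
      by metis
    \<comment> \<open>Comparing the metrics shows that \<open>l (Suc j)\<close> is also a
      \<open>d j\<close>-limit of the orbit. Starting at \<open>Suc j\<close> keeps all terms in
      \<open>H (Suc j)\<close>, where the comparison is valid.\<close>
    have "l (Suc j) = l j" for j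
    proof (rule Metric_space.dist_null_unique[OF metric, where \<sigma> = "\<lambda>n. (P ^^ (Suc j + n)) x"])
      show "(\<lambda>n. d j ((P ^^ (Suc j + n)) x) (l j)) \<longlonglongrightarrow> 0"
        using LIMSEQ_Suc[OF conv[of j]] by simp
      show "(\<lambda>n. d j ((P ^^ (Suc j + n)) x) (l (Suc j))) \<longlonglongrightarrow> 0"
      proof (rule tendsto_sandwich[where f = "\<lambda>_. 0"])
        show "(\<lambda>n. \<alpha> (Suc j) * d (Suc j) ((P ^^ (Suc j + n)) x) (l (Suc j))) \<longlonglongrightarrow> 0"
          using tendsto_mult_left[OF conv[of "Suc j"], of "\<alpha> (Suc j)"] by simp
        show "\<forall>\<^sub>F n in sequentially. d j ((P ^^ (Suc j + n)) x) (l (Suc j))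
            \<le> \<alpha> (Suc j) * d (Suc j) ((P ^^ (Suc j + n)) x) (l (Suc j))"
          by (intro always_eventually allI metric_le mem iter_mem'[OF x]) simp
      qed (simp_all add: Metric_space.nonneg[OF metric])
      show "(P ^^ (Suc j + n)) x \<in> H j" for n
        by (rule iter_mem'[OF x]) simp
    qed (use mem chain in auto)
    then have l: "l j = l 0" for j
      by (induction j) auto
    have in_all: "l 0 \<in> H j" for j
      using mem l by metis
    \<comment> \<open>The case \<open>m = 1\<close> of \<open>iter_lipschitz\<close> makes
      \<open>P\<close> continuous for \<open>d 0\<close>, so the shifted orbit converges both to
      \<open>l 0\<close> and to \<open>P (l 0)\<close>.\<close>
    have "P (l 0) = l 0"
    proof (rule Metric_space.dist_null_unique[OF metric, where \<sigma> = "\<lambda>n. (P ^^ (Suc n)) x"])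
      show "(\<lambda>n. d 0 ((P ^^ Suc n) x) (l 0)) \<longlonglongrightarrow> 0"
        using LIMSEQ_Suc[OF conv[of 0]] by simp
      show "(\<lambda>n. d 0 ((P ^^ Suc n) x) (P (l 0))) \<longlonglongrightarrow> 0"
      proof (rule tendsto_sandwich[where f = "\<lambda>_. 0"])
        show "(\<lambda>n. chain_series \<alpha> \<kappa> 0 1 * d 0 ((P ^^ n) x) (l 0)) \<longlonglongrightarrow> 0"
          using tendsto_mult_left[OF conv[of 0], of "chain_series \<alpha> \<kappa> 0 1"] by simp
        show "\<forall>\<^sub>F n in sequentially. d 0 ((P ^^ Suc n) x) (P (l 0))
            \<le> chain_series \<alpha> \<kappa> 0 1 * d 0 ((P ^^ n) x) (l 0)"
          using iter_lipschitz[OF iter_mem'[OF x] in_all, of 0 _ 1] by simp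
      qed (simp_all add: Metric_space.nonneg[OF metric])
      show "(P ^^ Suc n) x \<in> H 0" for n
        by (rule iter_mem'[OF x]) simp
    qed (use in_all P_maps in auto)
    moreover have "d j (l 0) ((P ^^ n) x) \<le> chain_const \<alpha> \<kappa> * (\<Prod>i\<in>{j<..n}. \<alpha> i * \<kappa> i) * D j"
      if "j \<le> n" for n j
    proof -
      define p where "p = (\<Prod>i\<in>{j<..n}. \<alpha> i * \<kappa> i)"
      have "0 \<le> p"
        unfolding p_def by (rule prod_nonneg) (use q_pos in \<open>auto simp: less_imp_le\<close>)
      have "d j (l 0) ((P ^^ n) x) \<le> (\<Sum>m. chain_series \<alpha> \<kappa> j (n - j + m) * D j)"
        using bound[of j "n - j"] that l[of j] by simp
      \<comment> \<open>Factoring out \<open>p\<close> leaves the series that starts at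
        \<open>n\<close>, whose sum is at most \<open>chain_const \<alpha> \<kappa>\<close>.\<close>
      also have "\<dots> = (\<Sum>m. (p * D j) * chain_series \<alpha> \<kappa> n m)"
        using chain_series_add[OF that] by (simp add: p_def mult_ac)
      also have "\<dots> = (p * D j) * (\<Sum>m. chain_series \<alpha> \<kappa> n m)"
        by (rule suminf_mult[OF series_summable])
      also have "\<dots> \<le> (p * D j) * chain_const \<alpha> \<kappa>"
        using \<open>0 \<le> p\<close> D_nonneg by (intro mult_left_mono series_le_const) auto
      finally show ?thesis by (simp add: p_def mult_ac)
    qed
    ultimately show ?thesis
      using in_all unfolding D_def by blast
  qed

  \<comment> \<open>One fixed point for all orbits\<close>
  obtain x0 where "x0 \<in> H 0" using nonempty by blast
  from limit[OF this] obtain z where z: "\<And>j. z \<in> H j" "P z = z" by blast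
  show ?thesis
  proof (intro conjI exI[of _ z] ballI impI wf)
    fix x assume "x \<in> H 0"
    \<comment> \<open>The limit obtained from \<open>x\<close> may a priori depend on
      \<open>x\<close>; being a fixed point in \<open>H 0\<close>, it equals \<open>z\<close>, and
      its estimate carries over.\<close>
    from limit[OF this] unique[OF _ z(1) _ z(2)]
    show "\<forall>n j. j \<le> n \<longrightarrow> d j z ((P ^^ n) x) \<le> chain_const \<alpha> \<kappa> * (\<Prod>i\<in>{j<..n}. \<alpha> i * \<kappa> i)
        * d j ((P ^^ (1 + j)) x) ((P ^^ j) x)"
      by metis
  qed (use z unique in auto)
qed

end
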